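(* Let $K\subseteq\Omega$ be a probability cover, i.e. $\sum_{\omega\in K}p_\omega>\epsilon$, and define the closed half-space $$\mathcal H_K=\Big\{\beta\in\mathbb R^N:\ \sum_{\omega\in K}\beta_\omega\ge|K|-1\Big\}.$$ Then $\mathcal H_K$ is an S-free set with respect to $$F=\Big\{(y,\beta)\in\mathbb R_+\times\{0,1\}^N:\ (\beta_\omega=0\Rightarrow y\ge h^\omega)\ \forall\omega\in\Omega,\ \ \sum_{\omega\in\Omega}p_\omega\beta_\omega\le\epsilon\Big\},$$ i.e. $\mathcal H_K$ is closed and convex and there is no $(y,\beta)\in F$ with $\beta\in\mathrm{int}(\mathcal H_K)$.
   Context: $\Omega=\{1,\dots,N\}$; $p_\omega>0$ with $\sum_{\omega\in\Omega}p_\omega=1$; $\epsilon\in(0,1)$ with $p_\omega\le\epsilon$ for all $\omega\in\Omega$; $h^\omega\ge0$ for all $\omega\in\Omega$. A closed convex set $B$ is S-free with respect to a set $S$ if $\mathrm{int}(B)\cap S=\emptyset$. *)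

theory Defs
  imports "HOL-Analysis.Analysis"
begin

text \<open>
  The scenario set \<open>\<Omega> = {1, \<dots>, N}\<close> is the finite type \<open>'n\<close>, with \<open>N = CARD('n)\<close>,
  and \<open>\<real>\<^sup>N\<close> is \<open>real ^ 'n\<close>.
\<close>

definition S_free :: "'a::real_normed_vector set \<Rightarrow> 'a set \<Rightarrow> bool" where
  "S_free B S \<longleftrightarrow> closed B \<and> convex B \<and> interior B \<inter> S = {}"

definition probability_cover :: "('n::finite \<Rightarrow> real) \<Rightarrow> real \<Rightarrow> 'n set \<Rightarrow> bool" where
  "probability_cover p \<epsilon> K \<longleftrightarrow> (\<Sum>\<omega>\<in>K. p \<omega>) > \<epsilon>"

definition cover_halfspace :: "'n::finite set \<Rightarrow> (real ^ 'n) set" where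
  "cover_halfspace K = {\<beta>. (\<Sum>\<omega>\<in>K. \<beta> $ \<omega>) \<ge> real (card K) - 1}"

definition feasible_set ::
  "('n::finite \<Rightarrow> real) \<Rightarrow> real \<Rightarrow> ('n \<Rightarrow> real) \<Rightarrow> (real \<times> (real ^ 'n)) set" where
  "feasible_set p \<epsilon> h =
     {(y, \<beta>). y \<ge> 0 \<and> (\<forall>\<omega>. \<beta> $ \<omega> \<in> {0, 1}) \<and>
             (\<forall>\<omega>. \<beta> $ \<omega> = 0 \<longrightarrow> y \<ge> h \<omega>) \<and>
             (\<Sum>\<omega>\<in>UNIV. p \<omega> * \<beta> $ \<omega>) \<le> \<epsilon>}"

text \<open>
  The half-space lies in \<open>\<real>\<^sup>N\<close> while the feasible set lies in \<open>\<real> \<times> \<real>\<^sup>N\<close>.  Being S-free with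
  respect to the latter means that no feasible \<open>(y, \<beta>)\<close> has \<open>\<beta>\<close> in the interior, taken in
  \<open>\<real>\<^sup>N\<close>, so \<open>S_free\<close> is used with the projection \<open>snd ` feasible_set p \<epsilon> h\<close>.
\<close>

end

theory Submission
  imports Defs
begin

text \<open>
  The interior of \<open>cover_halfspace K\<close> is cut out by the strict inequality \<open>(\<Sum>\<omega>\<in>K. \<beta> $ \<omega>) > card K - 1\<close>.  A binary \<open>\<beta>\<close> satisfies
  that strict inequality only if it equals 1 on all of \<open>K\<close>; but then the scenarios of \<open>K\<close>
  alone already have total probability exceeding \<open>\<epsilon>\<close>, against the knapsack constraint of the
  feasible set.
\<close>

lemma indicator_vec_inner:
  fixes \<beta> :: "real ^ 'n::finite"
  shows "(\<chi> \<omega>. indicator K \<omega>) \<bullet> \<beta> = (\<Sum>\<omega>\<in>K. \<beta> $ \<omega>)"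
  by (simp add: inner_vec_def indicator_times_eq_if sum.If_cases)

lemma cover_halfspace_inner:
  "cover_halfspace K = {\<beta>. (\<chi> \<omega>. indicator K \<omega>) \<bullet> \<beta> \<ge> real (card K) - 1}"
  by (simp add: cover_halfspace_def indicator_vec_inner)

text \<open>
  The usual description of the interior of a half-space needs a nonzero normal vector.  For
  \<open>K = {}\<close> the normal vanishes, but both \<open>0 \<ge> -1\<close> and \<open>0 > -1\<close> hold everywhere, so the formula
  survives.
\<close>

lemma interior_cover_halfspace:
  fixes K :: "'n::finite set"
  shows "interior (cover_halfspace K) = {\<beta>. (\<Sum>\<omega>\<in>K. \<beta> $ \<omega>) > real (card K) - 1}"
proof (cases "K = {}")
  case True
  then show ?thesis by (simp add: cover_halfspace_def)
next
  case False
  let ?a = "(\<chi> \<omega>. indicator K \<omega>) :: real ^ 'n"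
  from False have "?a \<noteq> 0"
    by (auto simp: vec_eq_iff indicator_eq_0_iff)
  then have "interior (cover_halfspace K) = {\<beta>. ?a \<bullet> \<beta> > real (card K) - 1}"
    by (simp add: cover_halfspace_inner)
  then show ?thesis by (simp add: indicator_vec_inner)
qed

text \<open>A single zero entry costs the sum a full unit, which is all the slack there is.\<close>

lemma binary_sum_gt_card_minus_one_imp_all_one:
  fixes f :: "'a \<Rightarrow> real"
  assumes "finite K" and binary: "\<And>x. x \<in> K \<Longrightarrow> f x \<in> {0, 1}"
    and gt: "(\<Sum>x\<in>K. f x) > real (card K) - 1" and "k \<in> K"
  shows "f k = 1"
proof (rule ccontr)
  assume "f k \<noteq> 1"
  with binary[OF \<open>k \<in> K\<close>] have "f k = 0" by simp
  then have "(\<Sum>x\<in>K. f x) = (\<Sum>x\<in>K - {k}. f x)"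
    using \<open>finite K\<close> \<open>k \<in> K\<close> by (simp add: sum.remove)
  also have "\<dots> \<le> (\<Sum>x\<in>K - {k}. 1)"
    using binary by (intro sum_mono) fastforce
  also have "\<dots> = real (card K) - 1"
  proof -
    have "card K \<ge> 1"
      using \<open>finite K\<close> \<open>k \<in> K\<close> by (auto simp: Suc_le_eq card_gt_0_iff)
    then show ?thesis
      using \<open>k \<in> K\<close> by (simp add: of_nat_diff)
  qed
  finally show False using gt by simp
qed

theorem lemma3:
  fixes p h :: "'n::finite \<Rightarrow> real" and \<epsilon> :: real and K :: "'n set"
  assumes "\<And>\<omega>. p \<omega> > 0"
    and "(\<Sum>\<omega>\<in>UNIV. p \<omega>) = 1"
    and "0 < \<epsilon>" and "\<epsilon> < 1"
    and "\<And>\<omega>. p \<omega> \<le> \<epsilon>"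
    and "\<And>\<omega>. h \<omega> \<ge> 0"
    and "probability_cover p \<epsilon> K"
  shows "S_free (cover_halfspace K) (snd ` feasible_set p \<epsilon> h)"
  unfolding S_free_def
proof (intro conjI)
  show "closed (cover_halfspace K)"
    unfolding cover_halfspace_inner by (rule closed_halfspace_ge)
  show "convex (cover_halfspace K)"
    unfolding cover_halfspace_inner by (rule convex_halfspace_ge)
  show "interior (cover_halfspace K) \<inter> snd ` feasible_set p \<epsilon> h = {}"
  proof (rule equals0I)
    fix \<beta> assume "\<beta> \<in> interior (cover_halfspace K) \<inter> snd ` feasible_set p \<epsilon> h"
    then have gt: "(\<Sum>\<omega>\<in>K. \<beta> $ \<omega>) > real (card K) - 1"
      and binary: "\<beta> $ \<omega> \<in> {0, 1}"
      and knapsack: "(\<Sum>\<omega>\<in>UNIV. p \<omega> * \<beta> $ \<omega>) \<le> \<epsilon>" for \<omega>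
      by (auto simp: interior_cover_halfspace feasible_set_def)
    have "\<beta> $ \<omega> = 1" if "\<omega> \<in> K" for \<omega>
      using binary_sum_gt_card_minus_one_imp_all_one[OF _ binary gt that] by simp
    then have "(\<Sum>\<omega>\<in>K. p \<omega>) = (\<Sum>\<omega>\<in>K. p \<omega> * \<beta> $ \<omega>)"
      by simp
    also have "\<dots> \<le> (\<Sum>\<omega>\<in>UNIV. p \<omega> * \<beta> $ \<omega>)"
    proof (intro sum_mono2)
      show "0 \<le> p \<omega> * \<beta> $ \<omega>" for \<omega>
        using assms(1)[of \<omega>] binary[of \<omega>] by auto
    qed auto
    finally show False
      using knapsack assms(7) by (simp add: probability_cover_def)
  qed
qed

end
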